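(* The following two assertions are equivalent: (a) every graph $G$ with $\alpha(G)\le 2$ contains an immersion of $K_{\chi(G)}$; (b) every graph $G$ with $\alpha(G)\le 2$ contains an immersion of $K_{\lceil n/2\rceil}$, where $n=|V(G)|$.
   Context: All graphs are finite and simple (no loops, no parallel edges). $K_t$ denotes the complete graph on $t$ vertices, $\chi(G)$ the chromatic number of $G$, and $\alpha(G)$ the independence number of $G$ (maximum size of an independent set). A graph $G$ contains an immersion of a graph $H$ if there is an injective function $\phi:V(H)\to V(G)$ such that: (1) for every edge $uv\in E(H)$ there is a path $P_{uv}$ in $G$ connecting $\phi(u)$ and $\phi(v)$; (2) the paths $\{P_{uv}: uv\in E(H)\}$ are pairwise edge-disjoint. *)

theory Defs
  imports
    Complex_Main
    "HOL-Library.Infinite_Typeclass"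
    "HOL-Library.Disjoint_Sets"
    "Graph_Theory.Graph_Theory"
begin

text \<open>
  A finite simple graph is a \<^locale>\<open>pair_graph\<close>: a finite symmetric loopfree relation
  on its vertex set, where each undirected edge is represented by two opposite arcs.
  The null graph is allowed. Statements about all finite graphs quantify over graphs whose vertices
  lie in a fixed type of class \<^class>\<open>infinite\<close>, which contains a copy of every finite graph.
\<close>

text \<open>Forgets the orientation of arcs: two opposite arcs give the same edge.\<close>
definition undirected :: "'a rel \<Rightarrow> 'a set set" where
  "undirected A = (\<lambda>(u, v). {u, v}) ` A"

abbreviation uedges :: "'a pair_pre_digraph \<Rightarrow> 'a set set" where
  "uedges G \<equiv> undirected (parcs G)"

definition independent_set :: "'a pair_pre_digraph \<Rightarrow> 'a set \<Rightarrow> bool" where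
  "independent_set G S \<longleftrightarrow> S \<subseteq> pverts G \<and> (\<forall>u\<in>S. \<forall>v\<in>S. (u, v) \<notin> parcs G)"

definition independence_number :: "'a pair_pre_digraph \<Rightarrow> nat" where
  "independence_number G = Max {card S | S. independent_set G S}"

definition proper_coloring :: "'a pair_pre_digraph \<Rightarrow> nat \<Rightarrow> ('a \<Rightarrow> nat) \<Rightarrow> bool" where
  "proper_coloring G k c \<longleftrightarrow>
     c ` pverts G \<subseteq> {..<k} \<and> (\<forall>(u, v)\<in>parcs G. c u \<noteq> c v)"

definition chromatic_number :: "'a pair_pre_digraph \<Rightarrow> nat" where
  "chromatic_number G = (LEAST k. \<exists>c. proper_coloring G k c)"

definition complete_graph :: "nat \<Rightarrow> nat pair_pre_digraph" where
  "complete_graph t = \<lparr> pverts = {..<t}, parcs = {(i, j). i < t \<and> j < t \<and> i \<noteq> j} \<rparr>"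

lemma complete_graph_complete_digraph: "K\<^bsub>t\<^esub> (with_proj (complete_graph t))"
proof -
  have fin: "finite {(i, j). i < t \<and> j < t \<and> i \<noteq> j}"
    by (rule finite_subset[of _ "{..<t} \<times> {..<t}"]) auto
  have "pair_graph (complete_graph t)"
    by unfold_locales
      (auto simp: complete_graph_def symmetric_def sym_def intro: fin)
  then interpret pair_graph "complete_graph t" .
  have "graph (with_proj (complete_graph t))"
    by unfold_locales
  then show ?thesis
    by (auto simp: complete_digraph_def complete_graph_def)
qed

text \<open>
  \<open>P e\<close> is the path for the undirected edge \<open>e\<close> of \<open>H\<close>. It may be listed starting from either
  end, so only the set of its two ends is prescribed. Edge-disjointness refers to undirected
  edges: distinct paths may not use opposite arcs of the same edge either.
\<close>
definition contains_immersion :: "'a pair_pre_digraph \<Rightarrow> 'b pair_pre_digraph \<Rightarrow> bool" where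
  "contains_immersion G H \<longleftrightarrow>
     (\<exists>(\<phi> :: 'b \<Rightarrow> 'a) (P :: 'b set \<Rightarrow> 'a list).
        inj_on \<phi> (pverts H) \<and> \<phi> ` pverts H \<subseteq> pverts G \<and>
        (\<forall>(u, v)\<in>parcs H. vpath (P {u, v}) (with_proj G) \<and>
           {hd (P {u, v}), last (P {u, v})} = {\<phi> u, \<phi> v}) \<and>
        disjoint_family_on (\<lambda>e. undirected (set (vwalk_arcs (P e)))) (uedges H))"

end

theory Submission
  imports Defs
begin

text \<open>
  A clique immersion restricts to any smaller clique, so only the inequalities between the two clique
  sizes matter. Colour classes have at most two vertices when \<open>\<alpha>(G) \<le> 2\<close>, hence
  \<open>\<chi>(G) \<ge> n/2\<close> and the assertion about \<open>\<chi>(G)\<close> implies the one about \<open>\<lceil>n/2\<rceil>\<close>.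

  For the converse, note that an optimal colouring is the same thing as a maximum matching of the
  complement \<open>H\<close> of \<open>G\<close>: colour classes of size two are matching edges, so
  \<open>\<chi>(G) = n - \<nu>(H)\<close> with \<open>\<nu>(H)\<close> the matching number. This is proved as the two inequalities
  \<open>chromatic_le_of_matching\<close> and \<open>matching_of_optimal_coloring\<close>. Now induct on \<open>n\<close>.

  If some vertex \<open>v\<close> is covered by every maximum matching of \<open>H\<close>, deleting it lowers both \<open>n\<close> and
  \<open>\<nu>(H)\<close>, so the chromatic number does not drop and \<open>G - v\<close> already contains the required
  immersion. Otherwise every vertex is missed by some maximum matching. Call two vertices related if
  they are equal or no maximum matching misses both. Adjacent vertices of \<open>H\<close> are related, and the
  heart of Gallai's lemma on factor-critical graphs says that this relation is transitive
  (\<open>Gallai_transitivity\<close>). If it has a single class, a maximum matching misses at most one vertex,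
  so \<open>\<chi>(G) \<le> \<lceil>n/2\<rceil>\<close> and the hypothesis applies to \<open>G\<close> itself. If there are several classes, no
  edge of \<open>H\<close> leaves a class, so \<open>G\<close> is the join of the subgraphs induced by a class and by its
  complement. Immersions in the two sides combine, by means of the edges between them, into an
  immersion of a clique of the summed size (\<open>contains_immersion_join\<close>), which is at least
  \<open>\<chi>(G)\<close> by subadditivity of the chromatic number.
\<close>

section \<open>Maximum matchings and Gallai's lemma\<close>

definition matching :: "'a set set \<Rightarrow> 'a set set \<Rightarrow> bool" where
  "matching E M \<longleftrightarrow> M \<subseteq> E \<and> disjoint M"

definition maximum_matching :: "'a set set \<Rightarrow> 'a set set \<Rightarrow> bool" where
  "maximum_matching E M \<longleftrightarrow> matching E M \<and> (\<forall>N. matching E N \<longrightarrow> card N \<le> card M)"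

lemma maximum_matching_exists:
  assumes "finite E"
  obtains M where "maximum_matching E M"
proof -
  have "matching E {}"
    by (simp add: matching_def)
  moreover have "card N \<le> card E" if "matching E N" for N
    using that assms by (simp add: matching_def card_mono)
  ultimately obtain M where "matching E M" "\<And>N. matching E N \<Longrightarrow> card N \<le> card M"
    using ex_has_greatest_nat[of "matching E" "{}" card "Suc (card E)"] by (auto simp: less_Suc_eq_le)
  then show ?thesis
    using that by (auto simp: maximum_matching_def)
qed

lemma maximum_matchingI:
  assumes "maximum_matching E M" "matching E N" "card M \<le> card N"
  shows "maximum_matching E N"
  using assms by (auto simp: maximum_matching_def intro: order_trans)

lemma card_Union_matching:
  assumes "\<forall>e\<in>E. card e = 2" "matching E M"
  shows "card (\<Union>M) = 2 * card M"
proof -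
  have "card (\<Union>M) = sum card M"
    using assms by (intro card_Union_disjoint)
      (fastforce simp: matching_def disjoint_def disjnt_def pairwise_def intro: card_ge_0_finite)+
  also have "\<dots> = sum (\<lambda>_. 2) M"
    using assms by (intro sum.cong) (auto simp: matching_def)
  finally show ?thesis by simp
qed

text \<open>For \<open>u = v\<close> this says that some maximum matching misses the single vertex \<open>u\<close>.\<close>
definition jointly_missed :: "'a set set \<Rightarrow> 'a \<Rightarrow> 'a \<Rightarrow> bool" where
  "jointly_missed E u v \<longleftrightarrow> (\<exists>M. maximum_matching E M \<and> u \<notin> \<Union>M \<and> v \<notin> \<Union>M)"

text \<open>An edge with both ends uncovered could be added to the matching.\<close>
lemma edge_not_jointly_missed:
  assumes "finite E" "{u, v} \<in> E"
  shows "\<not> jointly_missed E u v"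
proof
  assume "jointly_missed E u v"
  then obtain M where M: "maximum_matching E M" "u \<notin> \<Union>M" "v \<notin> \<Union>M"
    by (auto simp: jointly_missed_def)
  have "matching E (insert {u, v} M)"
    using M assms by (auto simp: maximum_matching_def matching_def disjoint_def)
  moreover have "card (insert {u, v} M) = Suc (card M)"
    using M assms finite_subset[of M E]
    by (subst card_insert_disjoint) (auto simp: maximum_matching_def matching_def)
  ultimately show False
    using M(1) unfolding maximum_matching_def by fastforce
qed

text \<open>
  The exchange argument behind Gallai's lemma, usually run along a shortest path, only needs three
  vertices. Suppose \<open>M\<close> misses \<open>u\<close> and \<open>v\<close>, while \<open>N\<close> misses \<open>t\<close>, and choose the two maximum
  matchings with as many common edges as possible. By hypothesis \<open>N\<close> covers \<open>u\<close> and \<open>v\<close>; since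
  both matchings cover equally many vertices, \<open>M\<close> covers two vertices that \<open>N\<close> misses, one of
  them different from \<open>t\<close>. Exchanging an edge of \<open>N\<close> for the edge of \<open>M\<close> at that vertex
  leaves \<open>t\<close> uncovered and brings the two matchings closer together.
\<close>
lemma Gallai_transitivity:
  assumes fin: "finite E" and E2: "\<forall>e\<in>E. card e = 2"
    and t_missable: "jointly_missed E t t"
    and ut: "\<not> jointly_missed E u t" and tv: "\<not> jointly_missed E t v"
    and "u \<noteq> v"
  shows "\<not> jointly_missed E u v"
proof
  assume "jointly_missed E u v"
  define R where "R = (\<lambda>(M, N). maximum_matching E M \<and> u \<notin> \<Union>M \<and> v \<notin> \<Union>M \<and>
    maximum_matching E N \<and> t \<notin> \<Union>N)"
  obtain M0 N0 where "R (M0, N0)"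
    using \<open>jointly_missed E u v\<close> t_missable by (auto simp: R_def jointly_missed_def)
  moreover have "card (fst p \<inter> snd p) \<le> card E" if "R p" for p
    using that fin
    by (intro card_mono) (auto simp: R_def maximum_matching_def matching_def split: prod.splits)
  ultimately obtain M N where "R (M, N)"
    and closest: "\<And>M' N'. R (M', N') \<Longrightarrow> card (M' \<inter> N') \<le> card (M \<inter> N)"
    using ex_has_greatest_nat[of R "(M0, N0)" "\<lambda>p. card (fst p \<inter> snd p)" "Suc (card E)"]
    by (fastforce simp: less_Suc_eq_le)
  then have M: "maximum_matching E M" "u \<notin> \<Union>M" "v \<notin> \<Union>M"
    and N: "maximum_matching E N" "t \<notin> \<Union>N"
    by (auto simp: R_def)
  have mM: "matching E M" and mN: "matching E N" and "card M = card N"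
    using M(1) N(1) by (auto simp: maximum_matching_def intro: antisym)
  have finM: "finite M" and finN: "finite N"
    using mM mN fin by (auto simp: matching_def intro: finite_subset)
  have fin_edge: "finite e" if "e \<in> E" for e
    using E2 that by (intro card_ge_0_finite) auto
  have finU: "finite (\<Union>M)" "finite (\<Union>N)"
    using finM finN mM mN fin_edge by (auto simp: matching_def)
  have "{u, v} \<subseteq> \<Union>N - \<Union>M"
    using ut tv M N by (auto simp: jointly_missed_def)
  then have "2 \<le> card (\<Union>N - \<Union>M)"
    using card_mono[of "\<Union>N - \<Union>M" "{u, v}"] finU \<open>u \<noteq> v\<close> by simp
  also have "card (\<Union>N - \<Union>M) = card (\<Union>M - \<Union>N)"
    using card_Union_matching[OF E2 mM] card_Union_matching[OF E2 mN] \<open>card M = card N\<close> finU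
      card_Diff_subset_Int[of "\<Union>N" "\<Union>M"] card_Diff_subset_Int[of "\<Union>M" "\<Union>N"]
    by (simp add: Int_commute)
  finally have "\<not> \<Union>M - \<Union>N \<subseteq> {t}"
    using card_mono[of "{t}" "\<Union>M - \<Union>N"] by auto
  then obtain x e where x: "x \<noteq> t" "x \<notin> \<Union>N" "x \<in> e" "e \<in> M"
    by auto
  then have "card e = 2" "e \<in> E"
    using E2 mM by (auto simp: matching_def)
  then obtain y where e: "e = {x, y}"
    using \<open>x \<in> e\<close> by (auto simp: card_2_iff)
  have "y \<in> \<Union>N"
    using edge_not_jointly_missed[OF fin, of x y] \<open>e \<in> E\<close> e x N
    by (auto simp: jointly_missed_def)
  then obtain f where f: "f \<in> N" "y \<in> f"
    by auto
  \<comment> \<open>The only edge of \<open>M\<close> at \<open>y\<close> is \<open>e\<close>, and \<open>f\<close> avoids \<open>x\<close>: nothing common is lost in the exchange.\<close>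
  have "f \<notin> M"
    using f x e mM by (force simp: matching_def disjoint_def)
  have "e \<notin> N"
    using x by auto
  define N' where "N' = insert e (N - {f})"
  have "matching E N'"
    using mN \<open>e \<in> E\<close> f x e unfolding N'_def matching_def disjoint_def by blast
  moreover have "card N' = card N"
    using card_Suc_Diff1[OF finN f(1)] finN \<open>e \<notin> N\<close> by (simp add: N'_def del: card_Diff_singleton)
  ultimately have "maximum_matching E N'"
    using maximum_matchingI[OF N(1)] by simp
  moreover have "t \<notin> \<Union>N'"
    using N x e \<open>y \<in> \<Union>N\<close> by (auto simp: N'_def)
  ultimately have "R (M, N')"
    using M by (simp add: R_def)
  moreover have "M \<inter> N' = insert e (M \<inter> N)"
    using \<open>f \<notin> M\<close> x by (auto simp: N'_def)
  ultimately have "card (insert e (M \<inter> N)) \<le> card (M \<inter> N)"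
    using closest by metis
  then show False
    using finM \<open>e \<notin> N\<close> by simp
qed

section \<open>Colourings as matchings of the complement\<close>

text \<open>The edges of the complement graph.\<close>
definition nonedges :: "'a pair_pre_digraph \<Rightarrow> 'a set set" where
  "nonedges G = {{u, v} | u v. u \<in> pverts G \<and> v \<in> pverts G \<and> u \<noteq> v \<and> (u, v) \<notin> parcs G}"

lemma card_nonedge: "\<forall>e\<in>nonedges G. card e = 2"
  by (auto simp: nonedges_def)

lemma nonedges_subset_Pow: "nonedges G \<subseteq> Pow (pverts G)"
  by (auto simp: nonedges_def)

lemma finite_nonedges: "finite (pverts G) \<Longrightarrow> finite (nonedges G)"
  by (rule finite_subset[OF nonedges_subset_Pow]) simp

lemma independence_number_le_iff:
  assumes "finite (pverts G)"
  shows "independence_number G \<le> k \<longleftrightarrow> (\<forall>S. independent_set G S \<longrightarrow> card S \<le> k)"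
proof -
  have "finite {S. independent_set G S}"
    by (rule finite_subset[of _ "Pow (pverts G)"]) (use assms in \<open>auto simp: independent_set_def\<close>)
  then have "finite {card S | S. independent_set G S}"
    by simp
  moreover have "independent_set G {}"
    by (simp add: independent_set_def)
  then have "{card S | S. independent_set G S} \<noteq> {}"
    by blast
  ultimately show ?thesis
    unfolding independence_number_def by (subst Max_le_iff) auto
qed

lemma chromatic_number_le: "proper_coloring G k c \<Longrightarrow> chromatic_number G \<le> k"
  unfolding chromatic_number_def by (rule Least_le) blast

lemma optimal_coloring_exists:
  assumes "pair_graph G"
  obtains c where "proper_coloring G (chromatic_number G) c"
proof -
  interpret pair_graph G by fact
  obtain h where h: "bij_betw h (pverts G) {0..<card (pverts G)}"
    using ex_bij_betw_finite_nat[OF pair_finite_verts] by blast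
  have "h u \<noteq> h v" if "(u, v) \<in> parcs G" for u v
    using that h pair_no_loops[OF that] wellformed'[OF that] by (auto simp: bij_betw_def dest: inj_onD)
  then have "proper_coloring G (card (pverts G)) h"
    using h by (auto simp: proper_coloring_def bij_betw_def)
  then have "\<exists>k c. proper_coloring G k c"
    by blast
  then have "\<exists>c. proper_coloring G (chromatic_number G) c"
    unfolding chromatic_number_def by (rule LeastI_ex)
  then show ?thesis
    using that by blast
qed

lemma independent_color_class:
  assumes "proper_coloring G k c"
  shows "independent_set G {v \<in> pverts G. c v = i}"
  using assms by (fastforce simp: independent_set_def proper_coloring_def)

lemma card_eq_sum_color_classes:
  assumes "finite (pverts G)" "proper_coloring G k c"
  shows "card (pverts G) = (\<Sum>i<k. card {v \<in> pverts G. c v = i})"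
proof -
  have "pverts G = (\<Union>i<k. {v \<in> pverts G. c v = i})"
    using assms by (auto simp: proper_coloring_def)
  also have "card \<dots> = (\<Sum>i<k. card {v \<in> pverts G. c v = i})"
    using assms by (intro card_UN_disjoint) auto
  finally show ?thesis .
qed

lemma card_verts_le_independence_times_chromatic:
  assumes "pair_graph G"
  shows "card (pverts G) \<le> chromatic_number G * independence_number G"
proof -
  interpret pair_graph G by fact
  obtain c where c: "proper_coloring G (chromatic_number G) c"
    using optimal_coloring_exists[OF assms] .
  have "card {v \<in> pverts G. c v = i} \<le> independence_number G" for i
    using independence_number_le_iff[OF pair_finite_verts, of "independence_number G"]
      independent_color_class[OF c] by blast
  then have "(\<Sum>i<chromatic_number G. card {v \<in> pverts G. c v = i}) \<le>
      (\<Sum>i<chromatic_number G. independence_number G)"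
    by (rule sum_mono)
  then show ?thesis
    by (simp add: card_eq_sum_color_classes[OF pair_finite_verts c])
qed

text \<open>
  Using one colour for each matching edge of the complement and one for each uncovered vertex saves
  one colour per edge.
\<close>
lemma chromatic_le_of_matching:
  assumes "pair_graph G" "matching (nonedges G) M"
  shows "chromatic_number G + card M \<le> card (pverts G)"
proof -
  interpret pair_graph G by fact
  have UM: "\<Union>M \<subseteq> pverts G"
    using assms(2) nonedges_subset_Pow[of G] by (auto simp: matching_def)
  have card_UM: "card (\<Union>M) = 2 * card M"
    by (rule card_Union_matching[OF card_nonedge assms(2)])
  have finM: "finite M"
    using assms(2) finite_nonedges[OF pair_finite_verts] by (auto simp: matching_def intro: finite_subset)
  \<comment> \<open>The palette consists of the colour classes themselves.\<close>
  define Q where "Q = M \<union> (\<lambda>v. {v}) ` (pverts G - \<Union>M)"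
  have "finite Q"
    using finM pair_finite_verts by (simp add: Q_def)
  have "card Q \<le> card M + card (pverts G - \<Union>M)"
    unfolding Q_def using pair_finite_verts
    by (intro order_trans[OF card_Un_le] add_left_mono card_image_le) simp
  also have "card (pverts G - \<Union>M) = card (pverts G) - 2 * card M"
    using UM card_UM pair_finite_verts by (simp add: card_Diff_subset finite_subset)
  finally have card_Q: "card Q + card M \<le> card (pverts G)"
    using card_mono[OF pair_finite_verts UM] card_UM by linarith
  have "\<forall>v\<in>pverts G. \<exists>q\<in>Q. v \<in> q"
    by (auto simp: Q_def)
  then obtain q where q: "\<And>v. v \<in> pverts G \<Longrightarrow> q v \<in> Q \<and> v \<in> q v"
    by metis
  obtain h where h: "bij_betw h Q {0..<card Q}"
    using ex_bij_betw_finite_nat[OF \<open>finite Q\<close>] by blast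
  have "h (q u) \<noteq> h (q v)" if uv: "(u, v) \<in> parcs G" for u v
  proof
    assume "h (q u) = h (q v)"
    then have "q u = q v"
      using h q wellformed'[OF uv] by (auto simp: bij_betw_def dest: inj_onD)
    then have "u \<in> q u" "v \<in> q u" "q u \<in> Q"
      using q wellformed'[OF uv] by auto
    moreover have "u \<noteq> v"
      using pair_no_loops[OF uv] by simp
    ultimately have "q u \<in> M"
      by (auto simp: Q_def)
    then have "q u \<in> nonedges G"
      using assms(2) unfolding matching_def by blast
    then have "(u, v) \<notin> parcs G \<or> (v, u) \<notin> parcs G"
      using \<open>u \<noteq> v\<close> \<open>u \<in> q u\<close> \<open>v \<in> q u\<close> by (auto simp: nonedges_def)
    then show False
      using uv pair_sym_arcs by (auto simp: symmetric_def dest: symD)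
  qed
  moreover have "(h \<circ> q) ` pverts G \<subseteq> {..<card Q}"
    using h q by (auto simp: bij_betw_def)
  ultimately have "proper_coloring G (card Q) (h \<circ> q)"
    by (auto simp: proper_coloring_def)
  then show ?thesis
    using chromatic_number_le card_Q by fastforce
qed

text \<open>
  Conversely, an independent pair that forms a colour class is an edge of the complement. As no
  class is larger, \<open>n\<close> exceeds the number of colours by at most the number of such pairs.
\<close>
lemma matching_of_optimal_coloring:
  assumes "pair_graph G" "independence_number G \<le> 2"
  obtains M where "matching (nonedges G) M" "card (pverts G) \<le> chromatic_number G + card M"
proof -
  interpret pair_graph G by fact
  let ?k = "chromatic_number G"
  obtain c where c: "proper_coloring G ?k c"
    using optimal_coloring_exists[OF assms(1)] .
  define C where "C i = {v \<in> pverts G. c v = i}" for i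
  have ind: "independent_set G (C i)" for i
    unfolding C_def by (rule independent_color_class[OF c])
  then have C2: "card (C i) \<le> 2" for i
    using assms(2) independence_number_le_iff[OF pair_finite_verts] by blast
  define I where "I = {i \<in> {..<?k}. card (C i) = 2}"
  have "C i \<in> nonedges G" if "i \<in> I" for i
  proof -
    obtain x y where "C i = {x, y}" "x \<noteq> y"
      using \<open>i \<in> I\<close> by (auto simp: I_def card_2_iff)
    with ind[of i] show ?thesis
      unfolding nonedges_def independent_set_def by blast
  qed
  moreover have "disjoint (C ` I)"
    by (auto simp: disjoint_def C_def)
  ultimately have M: "matching (nonedges G) (C ` I)"
    by (auto simp: matching_def)
  have "inj_on C I"
  proof (rule inj_onI)
    fix i j assume ij: "i \<in> I" "j \<in> I" "C i = C j"
    then have "C i \<noteq> {}"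
      by (auto simp: I_def)
    then show "i = j"
      using ij(3) by (auto simp: C_def)
  qed
  have "card (pverts G) = (\<Sum>i<?k. card (C i))"
    unfolding C_def by (rule card_eq_sum_color_classes[OF pair_finite_verts c])
  also have "\<dots> \<le> (\<Sum>i<?k. 1 + (if card (C i) = 2 then 1 else 0))"
    using C2 by (intro sum_mono) (auto simp: le_Suc_eq numeral_2_eq_2)
  also have "\<dots> = ?k + card I"
    unfolding sum.distrib I_def by (simp flip: sum.inter_filter)
  finally show ?thesis
    using that[OF M] card_image[OF \<open>inj_on C I\<close>] by simp
qed

section \<open>Induced subgraphs\<close>

definition induced :: "'a pair_pre_digraph \<Rightarrow> 'a set \<Rightarrow> 'a pair_pre_digraph" where
  "induced G S = \<lparr> pverts = S, parcs = parcs G \<inter> S \<times> S \<rparr>"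

lemma induced_simps [simp]:
  "pverts (induced G S) = S" "parcs (induced G S) = parcs G \<inter> S \<times> S"
  by (simp_all add: induced_def)

lemma pair_graph_induced:
  assumes "pair_graph G" "S \<subseteq> pverts G"
  shows "pair_graph (induced G S)"
proof -
  interpret pair_graph G by fact
  show ?thesis
    using finite_subset[OF assms(2) pair_finite_verts] pair_finite_arcs pair_sym_arcs pair_no_loops
    by unfold_locales (auto simp: symmetric_def sym_def)
qed

lemma independence_number_induced_le:
  assumes "finite (pverts G)" "S \<subseteq> pverts G" "independence_number G \<le> k"
  shows "independence_number (induced G S) \<le> k"
proof -
  have "finite (pverts (induced G S))"
    using finite_subset[OF assms(2,1)] by simp
  moreover have "independent_set G T" if "independent_set (induced G S) T" for T
    using that assms(2) unfolding independent_set_def induced_simps by blast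
  ultimately show ?thesis
    using assms(3) independence_number_le_iff[OF assms(1)]
      independence_number_le_iff[of "induced G S"] by blast
qed

lemma nonedges_induced:
  assumes "S \<subseteq> pverts G"
  shows "nonedges (induced G S) = {e \<in> nonedges G. e \<subseteq> S}"
proof (intro set_eqI iffI)
  fix e assume "e \<in> nonedges (induced G S)"
  then show "e \<in> {e \<in> nonedges G. e \<subseteq> S}"
    using assms unfolding nonedges_def by auto
next
  fix e assume "e \<in> {e \<in> nonedges G. e \<subseteq> S}"
  then show "e \<in> nonedges (induced G S)"
    unfolding nonedges_def by auto
qed

lemma chromatic_number_le_add:
  assumes G: "pair_graph G" and AB: "A \<union> B = pverts G"
  shows "chromatic_number G \<le> chromatic_number (induced G A) + chromatic_number (induced G B)"
proof -
  interpret pair_graph G by fact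
  let ?a = "chromatic_number (induced G A)" and ?b = "chromatic_number (induced G B)"
  obtain c where c: "proper_coloring (induced G A) ?a c"
    using optimal_coloring_exists[OF pair_graph_induced[OF G, of A]] AB by blast
  obtain d where d: "proper_coloring (induced G B) ?b d"
    using optimal_coloring_exists[OF pair_graph_induced[OF G, of B]] AB by blast
  have cA: "c v < ?a" if "v \<in> A" for v
    using c that by (auto simp: proper_coloring_def)
  have dB: "d v < ?b" if "v \<in> pverts G" "v \<notin> A" for v
    using d that AB by (auto simp: proper_coloring_def)
  have proper: "c u \<noteq> c v" if "(u, v) \<in> parcs G" "u \<in> A" "v \<in> A" for u v
    using c that by (auto simp: proper_coloring_def)
  have proper': "d u \<noteq> d v" if "(u, v) \<in> parcs G" "u \<notin> A" "v \<notin> A" for u v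
    using d that AB wellformed'[OF that(1)] by (auto simp: proper_coloring_def)
  define h where "h v = (if v \<in> A then c v else ?a + d v)" for v
  have "h v < ?a + ?b" if "v \<in> pverts G" for v
    using cA[of v] dB[OF that] by (auto simp: h_def)
  moreover have "h u \<noteq> h v" if "(u, v) \<in> parcs G" for u v
    using cA[of u] cA[of v] proper[OF that] proper'[OF that] by (auto simp: h_def)
  ultimately have "proper_coloring G (?a + ?b) h"
    by (auto simp: proper_coloring_def)
  then show ?thesis
    by (rule chromatic_number_le)
qed

section \<open>Immersions of complete graphs\<close>

lemma uedges_complete_graph: "uedges (complete_graph t) = {{i, j} | i j. i < t \<and> j < t \<and> i \<noteq> j}"
  by (auto simp: undirected_def complete_graph_def)

text \<open>
  The immersion condition for a complete graph, with its two witnesses as arguments: the branch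
  vertices \<open>\<phi>\<close> and the paths \<open>P\<close>.
\<close>
definition clique_immersion ::
  "'a pair_pre_digraph \<Rightarrow> nat \<Rightarrow> (nat \<Rightarrow> 'a) \<Rightarrow> (nat set \<Rightarrow> 'a list) \<Rightarrow> bool" where
  "clique_immersion G t \<phi> P \<longleftrightarrow>
     inj_on \<phi> {..<t} \<and> \<phi> ` {..<t} \<subseteq> pverts G \<and>
     (\<forall>i<t. \<forall>j<t. i \<noteq> j \<longrightarrow> vpath (P {i, j}) (with_proj G) \<and>
        {hd (P {i, j}), last (P {i, j})} = {\<phi> i, \<phi> j}) \<and>
     disjoint_family_on (\<lambda>e. undirected (set (vwalk_arcs (P e)))) (uedges (complete_graph t))"

lemma contains_immersion_complete_graph_iff:
  "contains_immersion G (complete_graph t) \<longleftrightarrow> (\<exists>\<phi> P. clique_immersion G t \<phi> P)"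
proof -
  have "pverts (complete_graph t) = {..<t}"
    and "(\<forall>(i, j)\<in>parcs (complete_graph t). R i j) \<longleftrightarrow> (\<forall>i<t. \<forall>j<t. i \<noteq> j \<longrightarrow> R i j)" for R
    by (auto simp: complete_graph_def)
  then show ?thesis
    unfolding contains_immersion_def clique_immersion_def by simp
qed

lemma contains_smaller_clique_immersion:
  assumes "contains_immersion G (complete_graph t)" "s \<le> t"
  shows "contains_immersion G (complete_graph s)"
proof -
  obtain \<phi> P where "clique_immersion G t \<phi> P"
    using assms(1) by (auto simp: contains_immersion_complete_graph_iff)
  moreover have "uedges (complete_graph s) \<subseteq> uedges (complete_graph t)"
    using assms(2) by (fastforce simp: uedges_complete_graph)
  ultimately have "clique_immersion G s \<phi> P"
    using assms(2) unfolding clique_immersion_def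
    by (auto simp: image_subset_iff intro: inj_on_subset disjoint_family_on_mono)
  then show ?thesis
    by (auto simp: contains_immersion_complete_graph_iff)
qed

lemma vpath_of_induced:
  assumes "S \<subseteq> pverts G" "vpath p (with_proj (induced G S))"
  shows "vpath p (with_proj G)"
  using assms by (auto simp: vpath_def vwalk_def)

lemma contains_immersion_of_induced:
  assumes "S \<subseteq> pverts G" "contains_immersion (induced G S) (complete_graph t)"
  shows "contains_immersion G (complete_graph t)"
proof -
  obtain \<phi> P where "clique_immersion (induced G S) t \<phi> P"
    using assms(2) by (auto simp: contains_immersion_complete_graph_iff)
  then have "clique_immersion G t \<phi> P"
    using assms(1) vpath_of_induced[OF assms(1)] unfolding clique_immersion_def by auto
  then show ?thesis
    by (auto simp: contains_immersion_complete_graph_iff)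
qed

lemma immersion_path_edges:
  assumes "clique_immersion (induced G S) t \<phi> P" "e \<in> uedges (complete_graph t)"
  shows "undirected (set (vwalk_arcs (P e))) \<subseteq> Pow S"
proof -
  have "vpath (P e) (with_proj (induced G S))"
    using assms by (auto simp: clique_immersion_def uedges_complete_graph)
  then show ?thesis
    by (auto simp: vpath_def vwalk_def undirected_def)
qed

text \<open>
  In a join, two branch vertices on different sides are adjacent, so the single edge between them
  serves as their path. The paths inside one side use only edges of that side, which makes the three
  kinds of paths edge-disjoint from each other.
\<close>
lemma contains_immersion_join:
  assumes sub: "A \<subseteq> pverts G" "B \<subseteq> pverts G" and "A \<inter> B = {}"
    and joined: "\<And>x y. x \<in> A \<Longrightarrow> y \<in> B \<Longrightarrow> (x, y) \<in> parcs G"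
    and "contains_immersion (induced G A) (complete_graph a)"
    and "contains_immersion (induced G B) (complete_graph b)"
  shows "contains_immersion G (complete_graph (a + b))"
proof -
  obtain \<phi> P where 1: "clique_immersion (induced G A) a \<phi> P"
    using assms by (auto simp: contains_immersion_complete_graph_iff)
  obtain \<psi> Q where 2: "clique_immersion (induced G B) b \<psi> Q"
    using assms by (auto simp: contains_immersion_complete_graph_iff)
  have \<phi>: "inj_on \<phi> {..<a}" "\<And>i. i < a \<Longrightarrow> \<phi> i \<in> A"
    using 1 by (auto simp: clique_immersion_def)
  have \<psi>: "inj_on \<psi> {..<b}" "\<And>i. i < b \<Longrightarrow> \<psi> i \<in> B"
    using 2 by (auto simp: clique_immersion_def)
  \<comment> \<open>The branch vertices from \<open>a\<close> on are those of the second immersion, with indices shifted by \<open>a\<close>.\<close>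
  define \<chi> where "\<chi> i = (if i < a then \<phi> i else \<psi> (i - a))" for i
  define sh where "sh e = (\<lambda>i. i - a) ` e" for e
  \<comment> \<open>A pair of indices on different sides has its minimum on the \<open>A\<close> side.\<close>
  define W where "W e = (if e \<subseteq> {..<a} then P e else if e \<subseteq> {a..} then Q (sh e)
    else [\<chi> (Min e), \<chi> (Max e)])" for e
  have \<chi>A: "\<chi> i \<in> A" if "i < a" for i
    using that \<phi> by (simp add: \<chi>_def)
  have \<chi>B: "\<chi> i \<in> B" if "a \<le> i" "i < a + b" for i
    using that \<psi> by (simp add: \<chi>_def)
  have inj: "inj_on \<chi> {..<a + b}"
  proof (rule inj_onI)
    fix i j assume ij: "i \<in> {..<a + b}" "j \<in> {..<a + b}" "\<chi> i = \<chi> j"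
    then have "i < a \<longleftrightarrow> j < a"
      using \<chi>A \<chi>B \<open>A \<inter> B = {}\<close> by (metis IntI empty_iff lessThan_iff not_less)
    then consider "i < a" "j < a" "\<phi> i = \<phi> j"
      | "a \<le> i" "a \<le> j" "i - a < b" "j - a < b" "\<psi> (i - a) = \<psi> (j - a)"
      using ij by (cases "i < a") (auto simp: \<chi>_def)
    then show "i = j"
    proof cases
      case 1
      then show ?thesis
        using \<phi>(1) by (auto dest: inj_onD)
    next
      case 2
      then have "i - a = j - a"
        using \<psi>(1) by (auto dest: inj_onD)
      then show ?thesis
        using 2 by simp
    qed
  qed
  have path: "vpath (W {i, j}) (with_proj G) \<and> {hd (W {i, j}), last (W {i, j})} = {\<chi> i, \<chi> j}"
    if ij: "i < j" "j < a + b" for i j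
  proof -
    consider "j < a" | "a \<le> i" | "i < a" "a \<le> j"
      using ij by linarith
    then show ?thesis
    proof cases
      case 1
      then have "W {i, j} = P {i, j}" "\<chi> i = \<phi> i" "\<chi> j = \<phi> j"
        using ij by (auto simp: W_def \<chi>_def)
      then show ?thesis
        using \<open>clique_immersion (induced G A) a \<phi> P\<close> 1 ij vpath_of_induced[OF sub(1)]
        by (auto simp: clique_immersion_def)
    next
      case 2
      then have "W {i, j} = Q {i - a, j - a}" "\<chi> i = \<psi> (i - a)" "\<chi> j = \<psi> (j - a)"
        using ij by (auto simp: W_def \<chi>_def sh_def)
      moreover have "i - a < b" "j - a < b" "i - a \<noteq> j - a"
        using 2 ij by auto
      ultimately show ?thesis
        using \<open>clique_immersion (induced G B) b \<psi> Q\<close> vpath_of_induced[OF sub(2)]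
        unfolding clique_immersion_def by metis
    next
      case 3
      then have "W {i, j} = [\<chi> i, \<chi> j]"
        using ij by (auto simp: W_def min_def max_def)
      moreover have "\<chi> i \<in> A" "\<chi> j \<in> B"
        using 3 ij \<chi>A \<chi>B by auto
      ultimately show ?thesis
        using joined sub \<open>A \<inter> B = {}\<close> by (auto simp: vpath_def vwalk_def)
    qed
  qed
  define F where "F e = undirected (set (vwalk_arcs (W e)))" for e
  have "disjoint_family_on F (uedges (complete_graph (a + b)))"
    unfolding disjoint_family_on_def
  proof (intro ballI impI)
    define inner where "inner = uedges (complete_graph a)"
    define outer where "outer = {{i, j} | i j. a \<le> i \<and> i < a + b \<and> a \<le> j \<and> j < a + b \<and> i \<noteq> j}"
    define cross where "cross = {{i, j} | i j. i < a \<and> a \<le> j \<and> j < a + b}"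
    have split: "e \<in> inner \<or> e \<in> outer \<or> e \<in> cross" if e: "e \<in> uedges (complete_graph (a + b))" for e
    proof -
      obtain i j where ij: "e = {i, j}" "i < a + b" "j < a + b" "i \<noteq> j"
        using e by (auto simp: uedges_complete_graph)
      consider "i < a" "j < a" | "a \<le> i" "a \<le> j" | "i < a" "a \<le> j" | "j < a" "a \<le> i"
        by linarith
      then show ?thesis
      proof cases
        case 1
        then have "e \<in> inner"
          unfolding inner_def uedges_complete_graph using ij by blast
        then show ?thesis ..
      next
        case 2
        then have "e \<in> outer"
          unfolding outer_def using ij by blast
        then show ?thesis by blast
      next
        case 3
        then have "e \<in> cross"
          unfolding cross_def using ij by blast
        then show ?thesis by blast
      next
        case 4
        moreover have "e = {j, i}"
          using ij by blast
        ultimately have "e \<in> cross"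
          unfolding cross_def using ij(2) by blast
        then show ?thesis by blast
      qed
    qed
    have inner: "F e = undirected (set (vwalk_arcs (P e)))" "F e \<subseteq> Pow A"
      if "e \<in> inner" for e
    proof -
      have "e \<subseteq> {..<a}"
        using that by (auto simp: inner_def uedges_complete_graph)
      then show "F e = undirected (set (vwalk_arcs (P e)))"
        by (simp add: F_def W_def)
      then show "F e \<subseteq> Pow A"
        using immersion_path_edges[OF 1] that by (simp add: inner_def)
    qed
    have outer: "F e = undirected (set (vwalk_arcs (Q (sh e))))" "F e \<subseteq> Pow B"
      "sh e \<in> uedges (complete_graph b)" "e = (\<lambda>i. i + a) ` sh e"
      if e: "e \<in> outer" for e
    proof -
      obtain i j where ij: "e = {i, j}" "a \<le> i" "i < a + b" "a \<le> j" "j < a + b" "i \<noteq> j"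
        using e by (auto simp: outer_def)
      then show F: "F e = undirected (set (vwalk_arcs (Q (sh e))))"
        by (auto simp: F_def W_def)
      have "sh e = {i - a, j - a}" "i - a < b" "j - a < b" "i - a \<noteq> j - a"
        using ij by (auto simp: sh_def)
      then show sh: "sh e \<in> uedges (complete_graph b)"
        unfolding uedges_complete_graph by blast
      then show "F e \<subseteq> Pow B"
        using immersion_path_edges[OF 2] F by simp
      show "e = (\<lambda>i. i + a) ` sh e"
        using ij by (auto simp: sh_def)
    qed
    have cross: "F e = {\<chi> ` e}" "e \<subseteq> {..<a + b}" "\<not> \<chi> ` e \<subseteq> A" "\<not> \<chi> ` e \<subseteq> B"
      if e: "e \<in> cross" for e
    proof -
      obtain i j where ij: "e = {i, j}" "i < a" "a \<le> j" "j < a + b"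
        using e by (auto simp: cross_def)
      then have "W e = [\<chi> i, \<chi> j]"
        by (auto simp: W_def min_def max_def)
      then show "F e = {\<chi> ` e}"
        using ij by (auto simp: F_def undirected_def)
      show "e \<subseteq> {..<a + b}"
        using ij by auto
      show "\<not> \<chi> ` e \<subseteq> A" "\<not> \<chi> ` e \<subseteq> B"
        using ij \<chi>A[of i] \<chi>B[of j] \<open>A \<inter> B = {}\<close> by auto
    qed
    \<comment> \<open>The two power sets share the empty set, which is not an edge.\<close>
    have no_empty: "{} \<notin> F e" for e
      by (auto simp: F_def undirected_def)
    have AB: "Pow A \<inter> Pow B = {{}}"
      using \<open>A \<inter> B = {}\<close> by auto
    have inner_inner: "F e \<inter> F f = {}" if "e \<in> inner" "f \<in> inner" "e \<noteq> f" for e f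
      using 1 that unfolding inner(1)[OF that(1)] inner(1)[OF that(2)]
      by (auto simp: clique_immersion_def disjoint_family_on_def inner_def)
    have outer_outer: "F e \<inter> F f = {}" if "e \<in> outer" "f \<in> outer" "e \<noteq> f" for e f
    proof -
      have "sh e \<noteq> sh f"
        using outer(4)[OF that(1)] outer(4)[OF that(2)] that(3) by metis
      moreover have "disjoint_family_on (\<lambda>e. undirected (set (vwalk_arcs (Q e)))) (uedges (complete_graph b))"
        using 2 by (simp add: clique_immersion_def)
      ultimately show ?thesis
        unfolding outer(1)[OF that(1)] outer(1)[OF that(2)]
        by (intro disjoint_family_onD) (auto intro: outer(3) that)
    qed
    have cross_cross: "F e \<inter> F f = {}" if "e \<in> cross" "f \<in> cross" "e \<noteq> f" for e f
    proof -
      have "\<chi> ` e \<noteq> \<chi> ` f"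
        using inj_on_image_eq_iff[OF inj cross(2)[OF that(1)] cross(2)[OF that(2)]] that(3) by simp
      then show ?thesis
        using cross(1)[OF that(1)] cross(1)[OF that(2)] by simp
    qed
    have inner_outer: "F e \<inter> F f = {}" if "e \<in> inner" "f \<in> outer" for e f
    proof -
      have "F e \<inter> F f \<subseteq> Pow A \<inter> Pow B"
        using inner(2)[OF that(1)] outer(2)[OF that(2)] by (rule Int_mono)
      then show ?thesis
        using no_empty[of e] unfolding AB by auto
    qed
    have inner_cross: "F e \<inter> F f = {}" if "e \<in> inner" "f \<in> cross" for e f
      using inner(2)[OF that(1)] cross(1,3)[OF that(2)] by auto
    have outer_cross: "F e \<inter> F f = {}" if "e \<in> outer" "f \<in> cross" for e f
      using outer(2)[OF that(1)] cross(1,4)[OF that(2)] by auto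
    fix e f
    assume "e \<in> uedges (complete_graph (a + b))" "f \<in> uedges (complete_graph (a + b))" "e \<noteq> f"
    then have "F e \<inter> F f = {} \<or> F f \<inter> F e = {}"
      using split[of e] split[of f] inner_inner[of e f] outer_outer[of e f] cross_cross[of e f]
        inner_outer[of e f] inner_outer[of f e] inner_cross[of e f] inner_cross[of f e]
        outer_cross[of e f] outer_cross[of f e]
      by argo
    then show "F e \<inter> F f = {}"
      by (simp add: Int_commute)
  qed
  moreover have "vpath (W {i, j}) (with_proj G) \<and> {hd (W {i, j}), last (W {i, j})} = {\<chi> i, \<chi> j}"
    if "i < a + b" "j < a + b" "i \<noteq> j" for i j
    using path[of i j] path[of j i] that by (cases "i < j") (auto simp: insert_commute)
  moreover have "\<chi> ` {..<a + b} \<subseteq> pverts G"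
    using \<chi>A \<chi>B sub by (auto, metis not_less subsetD)
  ultimately have "clique_immersion G (a + b) \<chi> W"
    using inj unfolding clique_immersion_def F_def by blast
  then show ?thesis
    by (auto simp: contains_immersion_complete_graph_iff)
qed

section \<open>The equivalence\<close>

text \<open>
  A maximum matching of the complement of \<open>G - v\<close> misses \<open>v\<close>, so under the last hypothesis it is
  not maximum for \<open>G\<close>: the matching number drops together with the number of vertices.
\<close>
lemma chromatic_number_delete_vertex:
  assumes G: "pair_graph G" "independence_number G \<le> 2" and v: "v \<in> pverts G"
    and ess: "\<not> jointly_missed (nonedges G) v v"
  shows "chromatic_number G \<le> chromatic_number (induced G (pverts G - {v}))"
proof -
  interpret pair_graph G by fact
  let ?G = "induced G (pverts G - {v})"
  obtain M where M: "maximum_matching (nonedges G) M"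
    using maximum_matching_exists[OF finite_nonedges[OF pair_finite_verts]] .
  obtain N where N: "matching (nonedges ?G) N" "card (pverts ?G) \<le> chromatic_number ?G + card N"
    using matching_of_optimal_coloring[of ?G] G pair_graph_induced[OF G(1)]
      independence_number_induced_le[OF pair_finite_verts _ G(2)] by (metis Diff_subset)
  have "matching (nonedges G) N" "v \<notin> \<Union>N"
    using N(1) nonedges_induced[of "pverts G - {v}" G] by (auto simp: matching_def)
  then have "card N < card M"
    using ess M maximum_matchingI[OF M, of N] unfolding jointly_missed_def by (meson not_less)
  moreover have "chromatic_number G + card M \<le> card (pverts G)"
    using chromatic_le_of_matching[OF G(1)] M by (simp add: maximum_matching_def)
  moreover have "card (pverts ?G) = card (pverts G) - 1"
    using v by simp
  ultimately show ?thesis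
    using N(2) by linarith
qed

text \<open>
  A maximum matching of the complement then misses at most one vertex, so all colour classes but one
  are pairs.
\<close>
lemma chromatic_number_le_half:
  assumes G: "pair_graph G"
    and ess: "\<And>u v. u \<in> pverts G \<Longrightarrow> v \<in> pverts G \<Longrightarrow> u \<noteq> v \<Longrightarrow> \<not> jointly_missed (nonedges G) u v"
  shows "chromatic_number G \<le> nat \<lceil>real (card (pverts G)) / 2\<rceil>"
proof -
  interpret pair_graph G by (rule G)
  obtain M where M: "maximum_matching (nonedges G) M"
    using maximum_matching_exists[OF finite_nonedges[OF pair_finite_verts]] .
  then have mM: "matching (nonedges G) M"
    by (simp add: maximum_matching_def)
  have UM: "\<Union>M \<subseteq> pverts G"
    using mM nonedges_subset_Pow[of G] by (auto simp: matching_def)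
  have "x = y" if "x \<in> pverts G - \<Union>M" "y \<in> pverts G - \<Union>M" for x y
    using ess[of x y] M that unfolding jointly_missed_def by blast
  then have "card (pverts G - \<Union>M) \<le> Suc 0"
    using pair_finite_verts by (subst card_le_Suc0_iff_eq) auto
  moreover have "card (pverts G - \<Union>M) = card (pverts G) - 2 * card M"
    using UM card_Union_matching[OF card_nonedge mM] pair_finite_verts
    by (simp add: card_Diff_subset finite_subset)
  moreover have "chromatic_number G + card M \<le> card (pverts G)"
    by (rule chromatic_le_of_matching[OF G mM])
  ultimately have "2 * chromatic_number G \<le> card (pverts G) + 1"
    by linarith
  then show ?thesis
    by linarith
qed

text \<open>
  The induction on the number of vertices. A smallest counterexample has neither a vertex that is
  covered by all maximum matchings of the complement nor a decomposition as a join, and such graphs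
  satisfy \<open>\<chi>(G) \<le> \<lceil>n/2\<rceil>\<close>.
\<close>
lemma contains_immersion_chromatic_number:
  fixes G :: "'a pair_pre_digraph"
  assumes half: "\<And>G :: 'a pair_pre_digraph. pair_graph G \<Longrightarrow> independence_number G \<le> 2 \<Longrightarrow>
      contains_immersion G (complete_graph (nat \<lceil>real (card (pverts G)) / 2\<rceil>))"
    and "pair_graph G" "independence_number G \<le> 2"
  shows "contains_immersion G (complete_graph (chromatic_number G))"
  using assms(2,3)
proof (induction "card (pverts G)" arbitrary: G rule: less_induct)
  case (less G)
  interpret pair_graph G by (rule less.prems(1))
  let ?E = "nonedges G"
  have IH: "contains_immersion (induced G S) (complete_graph (chromatic_number (induced G S)))"
    if "S \<subset> pverts G" for S
  proof (rule less.hyps)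
    show "card (pverts (induced G S)) < card (pverts G)"
      using psubset_card_mono[OF pair_finite_verts that] by simp
    have "S \<subseteq> pverts G"
      using that by simp
    then show "pair_graph (induced G S)" "independence_number (induced G S) \<le> 2"
      using pair_graph_induced[OF less.prems(1)] less.prems(2)
        independence_number_induced_le[OF pair_finite_verts] by simp_all
  qed
  show ?case
  proof (cases "\<forall>v\<in>pverts G. jointly_missed ?E v v")
    case False
    then obtain v where v: "v \<in> pverts G" "\<not> jointly_missed ?E v v"
      by blast
    let ?S = "pverts G - {v}"
    have "contains_immersion G (complete_graph (chromatic_number (induced G ?S)))"
      by (rule contains_immersion_of_induced[OF Diff_subset IH]) (use v(1) in blast)
    then show ?thesis
      using contains_smaller_clique_immersion
        chromatic_number_delete_vertex[OF less.prems v] by blast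
  next
    case missable: True
    show ?thesis
    proof (cases "\<exists>u\<in>pverts G. \<exists>v\<in>pverts G. u \<noteq> v \<and> jointly_missed ?E u v")
      case False
      then show ?thesis
        using half[OF less.prems] chromatic_number_le_half[OF less.prems(1)]
          contains_smaller_clique_immersion by blast
    next
      case True
      then obtain u v where uv: "u \<in> pverts G" "v \<in> pverts G" "u \<noteq> v" "jointly_missed ?E u v"
        by blast
      \<comment> \<open>\<open>A\<close> is the class of \<open>u\<close>, and \<open>v\<close> lies outside it.\<close>
      define A where "A = {x \<in> pverts G. x = u \<or> \<not> jointly_missed ?E u x}"
      define B where "B = pverts G - A"
      have joined: "(x, y) \<in> parcs G" if "x \<in> A" "y \<in> B" for x y
      proof (rule ccontr)
        assume "(x, y) \<notin> parcs G"
        then have "{x, y} \<in> ?E"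
          using that by (auto simp: nonedges_def A_def B_def)
        then have xy: "\<not> jointly_missed ?E x y"
          by (rule edge_not_jointly_missed[OF finite_nonedges[OF pair_finite_verts]])
        have y: "y \<in> pverts G" "y \<noteq> u" "jointly_missed ?E u y"
          using that by (auto simp: A_def B_def)
        moreover have "x \<noteq> u"
          using xy y by auto
        moreover have "jointly_missed ?E x x"
          using missable that by (auto simp: A_def)
        ultimately show False
          using Gallai_transitivity[OF finite_nonedges[OF pair_finite_verts] card_nonedge, of x u y]
            that xy by (auto simp: A_def)
      qed
      have AB: "A \<subset> pverts G" "B \<subset> pverts G" "A \<union> B = pverts G" "A \<inter> B = {}"
        using uv by (auto simp: A_def B_def)
      have "contains_immersion G
          (complete_graph (chromatic_number (induced G A) + chromatic_number (induced G B)))"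
        using AB joined by (intro contains_immersion_join[OF _ _ AB(4)] IH) auto
      then show ?thesis
        using contains_smaller_clique_immersion
          chromatic_number_le_add[OF less.prems(1) AB(3)] by blast
    qed
  qed
qed

theorem theorem1p5:
  shows "(\<forall>G :: 'a :: infinite pair_pre_digraph.
            pair_graph G \<and> independence_number G \<le> 2 \<longrightarrow>
              contains_immersion G (complete_graph (chromatic_number G)))
     \<longleftrightarrow> (\<forall>G :: 'a pair_pre_digraph.
            pair_graph G \<and> independence_number G \<le> 2 \<longrightarrow>
              contains_immersion G (complete_graph (nat \<lceil>real (card (pverts G)) / 2\<rceil>)))"
    (is "?chromatic \<longleftrightarrow> ?half")
proof
  assume ?chromatic
  show ?half
  proof (intro allI impI; elim conjE)
    fix G :: "'a pair_pre_digraph"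
    assume G: "pair_graph G" "independence_number G \<le> 2"
    have "card (pverts G) \<le> chromatic_number G * 2"
      using card_verts_le_independence_times_chromatic[OF G(1)] mult_le_mono2[OF G(2)]
      by (rule order_trans)
    then have "nat \<lceil>real (card (pverts G)) / 2\<rceil> \<le> chromatic_number G"
      by linarith
    then show "contains_immersion G (complete_graph (nat \<lceil>real (card (pverts G)) / 2\<rceil>))"
      using \<open>?chromatic\<close> G contains_smaller_clique_immersion by blast
  qed
next
  assume ?half
  then show ?chromatic
    using contains_immersion_chromatic_number by blast
qed

end
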